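(* Let $x^l=(\{\mathbf u^l[n]\},\{T^l[n]\},\{\tau_k^l[n]\},\{p_k^l[n]\})$, $l=0,1,2,\dots$, be the iterates of the alternating optimization algorithm described in the context, started from a feasible solution $x^0$ of the max-min throughput problem (P), with the convex subproblems (A) and (B) solved optimally in each iteration. Let $\eta^{\mathrm O}(x)=\eta^{\mathrm O}(\{\mathbf u[n]\},\{T[n]\},\{\tau_k[n]\},\{p_k[n]\})$ denote the objective value of (P), i.e. the max-min objective $\min_kQ_k^{\mathrm O}$, at $x$. Then for every $l$ $$\eta^{\mathrm O}(x^l)\le\eta^{\mathrm O}\left(\{\mathbf u^{l+1}[n]\},\{T^{l+0.5}[n]\},\{\tau_k^{l+0.5}[n]\},\{p_k^{l}[n]\}\right)\le\eta^{\mathrm O}(x^{l+1}),$$ so the objective value of (P) is non-decreasing after each iteration. Moreover, the max-min throughput is upper bounded by a finite value because the energy at the UAV and at the ground nodes is limited, and hence the algorithm is guaranteed to converge.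
   Context: Setting: a UAV flying at height $H$ collects data from $K$ ground nodes by time-division orthogonal multiple access (OMA). Node $k$ has horizontal position $\mathbf w_k\in\mathbb R^2$. The UAV path consists of $N$ segments with waypoints $\mathbf u[1],\dots,\mathbf u[N+1]\in\mathbb R^2$, from $\mathbf u_I$ to $\mathbf u_F$; $s[n]=\|\mathbf u[n+1]-\mathbf u[n]\|$. $T[n]$ is the duration of segment $n$, $\tau_k[n]$ the time allocated to node $k$ in segment $n$, and $p_k[n]$ its transmit power. The positive constants are $H,\delta,V_{\max},P_{\max},\gamma_0,P_0,P_i,U_{tip},v_0,d_0,\rho,s_r,A$, the UAV energy budget $E_U$ and the node energy budgets $E_k$. Indices range over $k\in\{1,\dots,K\}$, $n\in\{1,\dots,N\}$. Put $$Q_k^{\mathrm O}=\sum_{n=1}^N\tau_k[n]\log_2\left(1+\frac{\gamma_0p_k[n]}{\|\mathbf u[n]-\mathbf w_k\|^2+H^2}\right).$$ Constraints: (i) $\mathbf u[1]=\mathbf u_I$, $\mathbf u[N+1]=\mathbf u_F$; (ii) $\|\mathbf u[n+1]-\mathbf u[n]\|\le\min(\delta,V_{\max}T[n])$ for all $n$; (iii) $\sum_n\tau_k[n]p_k[n]\le E_k$ for all $k$; (iv) $\sum_k\tau_k[n]\le T[n]$ for all $n$; (v) $\tau_k[n]\ge0$ for all $k,n$; (vi) $0\le p_k[n]\le P_{\max}$ for all $k,n$; (E) $P_0\sum_n\left(T[n]+\frac{3s[n]^2}{U_{tip}^2T[n]}\right)+P_i\sum_n\omega[n]+\frac12d_0\rho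 s_rA\sum_n\frac{s[n]^3}{T[n]^2}\le E_U$. Problem (P) (a reformulation, with auxiliary variables, of maximizing $\min_kQ_k^{\mathrm O}$ under the energy budgets of UAV and nodes): maximize $\eta$ over $\eta,\{\mathbf u[n],T[n],\tau_k[n],p_k[n],\theta_k[n],\omega[n]\}$, $\omega[n]\ge0$, subject to (i)–(vi), (E), and $$\sum_n\theta_k[n]^2\ge\eta\ \ \forall k,\qquad \frac{\theta_k[n]^2}{\tau_k[n]}\le\log_2\left(1+\frac{\gamma_0p_k[n]}{\|\mathbf u[n]-\mathbf w_k\|^2+H^2}\right)\ \ \forall k,n,$$ $$\frac{T[n]^4}{\omega[n]^2}\le\omega[n]^2+\frac{\|\mathbf u[n+1]-\mathbf u[n]\|^2}{v_0^2}\ \ \forall n.$$ The auxiliary variables represent $\theta_k[n]^2=\tau_k[n]\log_2\left(1+\frac{\gamma_0p_k[n]}{\|\mathbf u[n]-\mathbf w_k\|^2+H^2}\right)$ and $\omega[n]=\left(\sqrt{T[n]^4+\frac{s[n]^4}{4v_0^4}}-\frac{s[n]^2}{2v_0^2}\right)^{1/2}$; in (B) below a further auxiliary variable $\varepsilon_k[n]$ represents $\varepsilon_k[n]^2=\tau_k[n]p_k[n]$. Superscript $c$ marks given local points at which first-order Taylor lower bounds are taken. Subproblem (A), with $p_k[n]$ fixed: maximize $\eta$ over $\eta,\{\mathbf u[n],T[n],\tau_k[n],\theta_k[n],\omega[n]\}$ subject to (i), (ii), (iii), (iv), (v), (E) and $$\sum_n\left(\theta_k^c[n]^2+2\theta_k^c[n](\theta_k[n]-\theta_k^c[n])\right)\ge\eta\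 \ \forall k,$$ $$\frac{\theta_k[n]^2}{\tau_k[n]}\le\log_2\left(1+\frac{\gamma_0p_k[n]}{D_k[n]}\right)-\varphi_k[n]\left(\|\mathbf u[n]-\mathbf w_k\|^2-\|\mathbf u^c[n]-\mathbf w_k\|^2\right)\ \ \forall k,n,$$ $$\frac{T[n]^4}{\omega[n]^2}\le\omega^c[n]^2+2\omega^c[n](\omega[n]-\omega^c[n])-\frac{\|\mathbf u^c[n+1]-\mathbf u^c[n]\|^2}{v_0^2}+\frac{2}{v_0^2}(\mathbf u^c[n+1]-\mathbf u^c[n])^T(\mathbf u[n+1]-\mathbf u[n])\ \ \forall n,$$ where $D_k[n]=\|\mathbf u^c[n]-\mathbf w_k\|^2+H^2$ and $\varphi_k[n]=\frac{(\log_2e)\gamma_0p_k[n]}{D_k[n](D_k[n]+\gamma_0p_k[n])}$. Subproblem (B), with $\mathbf u[n]$ (hence $s[n]$) fixed: maximize $\eta$ over $\eta,\{T[n],\tau_k[n],p_k[n],\theta_k[n],\omega[n],\varepsilon_k[n]\}$ subject to (iv), (v), (vi), (E) and $$\sum_n\left(\theta_k^c[n]^2+2\theta_k^c[n](\theta_k[n]-\theta_k^c[n])\right)\ge\eta\ \ \forall k,\qquad \frac{\theta_k[n]^2}{\tau_k[n]}\le\log_2\left(1+\frac{\gamma_0p_k[n]}{\|\mathbf u[n]-\mathbf w_k\|^2+H^2}\right)\ \ \forall k,n,$$ $$\sum_n\varepsilon_k[n]^2\le E_k\ \ \forall k,\qquad p_k[n]\le\frac{\varepsilon_k^c[n]^2}{\tau_k^c[n]}+\frac{2\varepsilon_k^c[n]}{\tau_k^c[n]}(\varepsilon_k[n]-\varepsilon_k^c[n])-\frac{\varepsilon_k^c[n]^2}{\tau_k^c[n]^2}(\tau_k[n]-\tau_k^c[n])\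 \ \forall k,n,$$ $$\frac{T[n]^4}{\omega[n]^2}\le\omega^c[n]^2+2\omega^c[n](\omega[n]-\omega^c[n])+\frac{s[n]^2}{v_0^2}\ \ \forall n.$$ Algorithm: initialize a feasible solution $x^0=\{\mathbf u^0[n],T^0[n],\tau_k^0[n],p_k^0[n]\}$ of (P), $l=0$. Repeat: solve (A) for given $\{p_k^l[n]\}$ and denote the optimal solution by $\{\mathbf u^{l+1}[n],T^{l+0.5}[n],\tau_k^{l+0.5}[n]\}$; solve (B) for given $\{\mathbf u^{l+1}[n]\}$ and denote the optimal solution by $\{p_k^{l+1}[n],T^{l+1}[n],\tau_k^{l+1}[n]\}$; set $l=l+1$; until the fractional increase of the objective value is below a threshold $\xi>0$. The solutions obtained are used as the input local points for what is solved next: (A) and (B) are each approximated at the most recently obtained solution.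
   Formalization: Subproblem (B) keeps the speed constraint (ii), which its listed constraints omit; without it an optimal T[n] can violate (ii) and the next step (A) can lower the objective. Where the local τ_k^c[n] is 0, the affine bound on p_k[n] in (B) is read as p_k[n] ≤ 0. *)

theory Defs
  imports "HOL-Analysis.Analysis"
begin

(* Nodes are numbered 1..nodes S, segments 1..segs S, waypoints 1..segs S + 1; values of the
   variables at other indices are irrelevant.  A family x_k[n] is written x k n. *)

record uav_sys =
  nodes :: nat                       (* K *)
  segs :: nat                        (* N *)
  height :: real                     (* H *)
  seg_max :: real                    (* delta *)
  v_max :: real
  p_max :: real
  gamma0 :: real
  P_blade :: real                    (* P_0 *)
  P_ind :: real                      (* P_i *)
  U_tip :: real
  v_ind :: real                      (* v_0 *)
  d_drag :: real                     (* d_0 *)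
  rho_air :: real
  s_rotor :: real                    (* s_r *)
  A_rotor :: real                    (* A *)
  E_uav :: real                      (* E_U *)
  E_node :: "nat \<Rightarrow> real"           (* E_k *)
  node_pos :: "nat \<Rightarrow> real^2"       (* w_k *)
  u_init :: "real^2"
  u_final :: "real^2"

type_synonym path = "nat \<Rightarrow> real^2"
type_synonym seg_var = "nat \<Rightarrow> real"
type_synonym node_var = "nat \<Rightarrow> nat \<Rightarrow> real"

definition valid_sys :: "uav_sys \<Rightarrow> bool" where
  "valid_sys S \<longleftrightarrow>
     1 \<le> nodes S \<and> 1 \<le> segs S \<and>
     0 < height S \<and> 0 < seg_max S \<and> 0 < v_max S \<and> 0 < p_max S \<and> 0 < gamma0 S \<and>
     0 < P_blade S \<and> 0 < P_ind S \<and> 0 < U_tip S \<and> 0 < v_ind S \<and> 0 < d_drag S \<and>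
     0 < rho_air S \<and> 0 < s_rotor S \<and> 0 < A_rotor S \<and> 0 < E_uav S \<and>
     (\<forall>k\<in>{1..nodes S}. 0 < E_node S k)"

definition seg_length :: "path \<Rightarrow> nat \<Rightarrow> real" where
  "seg_length u n = norm (u (n + 1) - u n)"

definition sq_dist :: "uav_sys \<Rightarrow> path \<Rightarrow> nat \<Rightarrow> nat \<Rightarrow> real" where
  "sq_dist S u k n = (norm (u n - node_pos S k))\<^sup>2 + (height S)\<^sup>2"

definition rate :: "uav_sys \<Rightarrow> path \<Rightarrow> node_var \<Rightarrow> nat \<Rightarrow> nat \<Rightarrow> real" where
  "rate S u p k n = log 2 (1 + gamma0 S * p k n / sq_dist S u k n)"

definition throughput :: "uav_sys \<Rightarrow> path \<Rightarrow> node_var \<Rightarrow> node_var \<Rightarrow> nat \<Rightarrow> real" where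
  "throughput S u \<tau> p k = (\<Sum>n=1..segs S. \<tau> k n * rate S u p k n)"

(* T does not enter the value; it is kept as an argument because the objective is a function of
   the whole point (u, T, tau, p). *)
definition max_min_obj ::
    "uav_sys \<Rightarrow> path \<Rightarrow> seg_var \<Rightarrow> node_var \<Rightarrow> node_var \<Rightarrow> real" where
  "max_min_obj S u T \<tau> p = Min (throughput S u \<tau> p ` {1..nodes S})"


section \<open>Constraints\<close>

(* tau_k[n], T[n] and omega[n] may vanish.  Fractions with such denominators are formed in ereal,
   where 0 / 0 = 0 and c / 0 = \<infinity> for c > 0: the lower semicontinuous extension of the convex
   functions theta^2/tau, s^2/T, s^3/T^2 and T^4/omega^2.  Division on real would give c / 0 = 0
   and make the constraints void at zero denominators. *)

definition con_i :: "uav_sys \<Rightarrow> path \<Rightarrow> bool" where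
  "con_i S u \<longleftrightarrow> u 1 = u_init S \<and> u (segs S + 1) = u_final S"

definition con_ii :: "uav_sys \<Rightarrow> path \<Rightarrow> seg_var \<Rightarrow> bool" where
  "con_ii S u T \<longleftrightarrow>
     (\<forall>n\<in>{1..segs S}. norm (u (n + 1) - u n) \<le> min (seg_max S) (v_max S * T n))"

definition con_iii :: "uav_sys \<Rightarrow> node_var \<Rightarrow> node_var \<Rightarrow> bool" where
  "con_iii S \<tau> p \<longleftrightarrow> (\<forall>k\<in>{1..nodes S}. (\<Sum>n=1..segs S. \<tau> k n * p k n) \<le> E_node S k)"

definition con_iv :: "uav_sys \<Rightarrow> seg_var \<Rightarrow> node_var \<Rightarrow> bool" where
  "con_iv S T \<tau> \<longleftrightarrow> (\<forall>n\<in>{1..segs S}. (\<Sum>k=1..nodes S. \<tau> k n) \<le> T n)"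

definition con_v :: "uav_sys \<Rightarrow> node_var \<Rightarrow> bool" where
  "con_v S \<tau> \<longleftrightarrow> (\<forall>k\<in>{1..nodes S}. \<forall>n\<in>{1..segs S}. 0 \<le> \<tau> k n)"

definition con_vi :: "uav_sys \<Rightarrow> node_var \<Rightarrow> bool" where
  "con_vi S p \<longleftrightarrow> (\<forall>k\<in>{1..nodes S}. \<forall>n\<in>{1..segs S}. 0 \<le> p k n \<and> p k n \<le> p_max S)"

definition con_E :: "uav_sys \<Rightarrow> path \<Rightarrow> seg_var \<Rightarrow> seg_var \<Rightarrow> bool" where
  "con_E S u T \<omega> \<longleftrightarrow>
     ereal (P_blade S) *
       (\<Sum>n=1..segs S. ereal (T n) +
          ereal (3 * (seg_length u n)\<^sup>2) / ereal ((U_tip S)\<^sup>2 * T n))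
     + ereal (P_ind S * (\<Sum>n=1..segs S. \<omega> n))
     + ereal (1/2 * d_drag S * rho_air S * s_rotor S * A_rotor S) *
       (\<Sum>n=1..segs S. ereal ((seg_length u n)^3) / ereal ((T n)\<^sup>2))
     \<le> ereal (E_uav S)"

definition omega_nonneg :: "uav_sys \<Rightarrow> seg_var \<Rightarrow> bool" where
  "omega_nonneg S \<omega> \<longleftrightarrow> (\<forall>n\<in>{1..segs S}. 0 \<le> \<omega> n)"


section \<open>Problem (P)\<close>

definition P_feasible :: "uav_sys \<Rightarrow> real \<Rightarrow> path \<Rightarrow> seg_var \<Rightarrow> node_var \<Rightarrow> node_var \<Rightarrow>
    node_var \<Rightarrow> seg_var \<Rightarrow> bool" where
  "P_feasible S \<eta> u T \<tau> p \<theta> \<omega> \<longleftrightarrow>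
     con_i S u \<and> con_ii S u T \<and> con_iii S \<tau> p \<and> con_iv S T \<tau> \<and> con_v S \<tau> \<and> con_vi S p \<and>
     con_E S u T \<omega> \<and> omega_nonneg S \<omega> \<and>
     (\<forall>k\<in>{1..nodes S}. (\<Sum>n=1..segs S. (\<theta> k n)\<^sup>2) \<ge> \<eta>) \<and>
     (\<forall>k\<in>{1..nodes S}. \<forall>n\<in>{1..segs S}.
        ereal ((\<theta> k n)\<^sup>2) / ereal (\<tau> k n) \<le> ereal (rate S u p k n)) \<and>
     (\<forall>n\<in>{1..segs S}.
        ereal ((T n)^4) / ereal ((\<omega> n)\<^sup>2)
        \<le> ereal ((\<omega> n)\<^sup>2 + (norm (u (n + 1) - u n))\<^sup>2 / (v_ind S)\<^sup>2))"

definition P_feasible_point ::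
    "uav_sys \<Rightarrow> path \<Rightarrow> seg_var \<Rightarrow> node_var \<Rightarrow> node_var \<Rightarrow> bool" where
  "P_feasible_point S u T \<tau> p \<longleftrightarrow> (\<exists>\<eta> \<theta> \<omega>. P_feasible S \<eta> u T \<tau> p \<theta> \<omega>)"


section \<open>Auxiliary variables at a local point\<close>

definition theta_of :: "uav_sys \<Rightarrow> path \<Rightarrow> node_var \<Rightarrow> node_var \<Rightarrow> node_var" where
  "theta_of S u \<tau> p k n = sqrt (\<tau> k n * rate S u p k n)"

definition omega_of :: "uav_sys \<Rightarrow> path \<Rightarrow> seg_var \<Rightarrow> seg_var" where
  "omega_of S u T n =
     sqrt (sqrt ((T n)^4 + (seg_length u n)^4 / (4 * (v_ind S)^4))
           - (seg_length u n)\<^sup>2 / (2 * (v_ind S)\<^sup>2))"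

definition epsilon_of :: "node_var \<Rightarrow> node_var \<Rightarrow> node_var" where
  "epsilon_of \<tau> p k n = sqrt (\<tau> k n * p k n)"


section \<open>Subproblem (A): fixed powers\<close>

definition phi :: "uav_sys \<Rightarrow> path \<Rightarrow> node_var \<Rightarrow> nat \<Rightarrow> nat \<Rightarrow> real" where
  "phi S uc p k n =
     log 2 (exp 1) * gamma0 S * p k n
     / (sq_dist S uc k n * (sq_dist S uc k n + gamma0 S * p k n))"

(* p: fixed powers; uc, thc, omc: local point; the remaining arguments are the variables. *)
definition A_feasible :: "uav_sys \<Rightarrow> node_var \<Rightarrow> path \<Rightarrow> node_var \<Rightarrow> seg_var \<Rightarrow>
    real \<Rightarrow> path \<Rightarrow> seg_var \<Rightarrow> node_var \<Rightarrow> node_var \<Rightarrow> seg_var \<Rightarrow> bool" where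
  "A_feasible S p uc thc omc \<eta> u T \<tau> \<theta> \<omega> \<longleftrightarrow>
     con_i S u \<and> con_ii S u T \<and> con_iii S \<tau> p \<and> con_iv S T \<tau> \<and> con_v S \<tau> \<and>
     con_E S u T \<omega> \<and> omega_nonneg S \<omega> \<and>
     (\<forall>k\<in>{1..nodes S}.
        (\<Sum>n=1..segs S. (thc k n)\<^sup>2 + 2 * thc k n * (\<theta> k n - thc k n)) \<ge> \<eta>) \<and>
     (\<forall>k\<in>{1..nodes S}. \<forall>n\<in>{1..segs S}.
        ereal ((\<theta> k n)\<^sup>2) / ereal (\<tau> k n)
        \<le> ereal (log 2 (1 + gamma0 S * p k n / sq_dist S uc k n)
                 - phi S uc p k n *
                   ((norm (u n - node_pos S k))\<^sup>2 - (norm (uc n - node_pos S k))\<^sup>2))) \<and>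
     (\<forall>n\<in>{1..segs S}.
        ereal ((T n)^4) / ereal ((\<omega> n)\<^sup>2)
        \<le> ereal ((omc n)\<^sup>2 + 2 * omc n * (\<omega> n - omc n)
                 - (norm (uc (n + 1) - uc n))\<^sup>2 / (v_ind S)\<^sup>2
                 + 2 / (v_ind S)\<^sup>2 * ((uc (n + 1) - uc n) \<bullet> (u (n + 1) - u n))))"

(* (u, T, tau) is an optimal solution of (A) for powers p, approximated at (uc, Tc, tauc, p). *)
definition A_solution :: "uav_sys \<Rightarrow> path \<Rightarrow> seg_var \<Rightarrow> node_var \<Rightarrow> node_var \<Rightarrow>
    path \<Rightarrow> seg_var \<Rightarrow> node_var \<Rightarrow> bool" where
  "A_solution S uc Tc \<tau>c p u T \<tau> \<longleftrightarrow>
     (let feas = A_feasible S p uc (theta_of S uc \<tau>c p) (omega_of S uc Tc)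
      in \<exists>\<eta> \<theta> \<omega>. feas \<eta> u T \<tau> \<theta> \<omega> \<and>
           (\<forall>\<eta>' u' T' \<tau>' \<theta>' \<omega>'. feas \<eta>' u' T' \<tau>' \<theta>' \<omega>' \<longrightarrow> \<eta>' \<le> \<eta>))"


section \<open>Subproblem (B): fixed waypoints\<close>

(* u: fixed waypoints; tauc, thc, omc, epc: local point; the remaining arguments are the variables.
   In the affine bound on p, real division gives the value 0 when tauc k n = 0 (epsilon vanishes
   there as well), so the constraint then reads p k n \<le> 0: a node without time gets no power. *)
definition B_feasible :: "uav_sys \<Rightarrow> path \<Rightarrow> node_var \<Rightarrow> node_var \<Rightarrow> seg_var \<Rightarrow> node_var \<Rightarrow>
    real \<Rightarrow> seg_var \<Rightarrow> node_var \<Rightarrow> node_var \<Rightarrow> node_var \<Rightarrow> seg_var \<Rightarrow> node_var \<Rightarrow> bool" where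
  "B_feasible S u \<tau>c thc omc epc \<eta> T \<tau> p \<theta> \<omega> \<epsilon> \<longleftrightarrow>
     con_iv S T \<tau> \<and> con_v S \<tau> \<and> con_vi S p \<and> con_E S u T \<omega> \<and> omega_nonneg S \<omega> \<and>
     (\<forall>k\<in>{1..nodes S}.
        (\<Sum>n=1..segs S. (thc k n)\<^sup>2 + 2 * thc k n * (\<theta> k n - thc k n)) \<ge> \<eta>) \<and>
     (\<forall>k\<in>{1..nodes S}. \<forall>n\<in>{1..segs S}.
        ereal ((\<theta> k n)\<^sup>2) / ereal (\<tau> k n) \<le> ereal (rate S u p k n)) \<and>
     (\<forall>k\<in>{1..nodes S}. (\<Sum>n=1..segs S. (\<epsilon> k n)\<^sup>2) \<le> E_node S k) \<and>
     (\<forall>k\<in>{1..nodes S}. \<forall>n\<in>{1..segs S}.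
        p k n \<le> (epc k n)\<^sup>2 / \<tau>c k n
                 + 2 * epc k n / \<tau>c k n * (\<epsilon> k n - epc k n)
                 - (epc k n)\<^sup>2 / (\<tau>c k n)\<^sup>2 * (\<tau> k n - \<tau>c k n)) \<and>
     (\<forall>n\<in>{1..segs S}.
        ereal ((T n)^4) / ereal ((\<omega> n)\<^sup>2)
        \<le> ereal ((omc n)\<^sup>2 + 2 * omc n * (\<omega> n - omc n)
                 + (seg_length u n)\<^sup>2 / (v_ind S)\<^sup>2))"

(* (T, tau, p) is an optimal solution of (B) for waypoints u, approximated at (u, Tc, tauc, pc).
   The durations stay subject to the speed limit (ii) of (P), which is not implied by the other
   constraints of (B).  Dropping it would let an optimal T violate (ii), so that the next iterate
   is infeasible for (P) and the following (A) step can lower the objective. *)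
definition B_solution :: "uav_sys \<Rightarrow> path \<Rightarrow> seg_var \<Rightarrow> node_var \<Rightarrow> node_var \<Rightarrow>
    seg_var \<Rightarrow> node_var \<Rightarrow> node_var \<Rightarrow> bool" where
  "B_solution S u Tc \<tau>c pc T \<tau> p \<longleftrightarrow>
     (let feas = (\<lambda>\<eta> T \<tau> p \<theta> \<omega> \<epsilon>. con_ii S u T \<and>
            B_feasible S u \<tau>c (theta_of S u \<tau>c pc) (omega_of S u Tc) (epsilon_of \<tau>c pc)
              \<eta> T \<tau> p \<theta> \<omega> \<epsilon>)
      in \<exists>\<eta> \<theta> \<omega> \<epsilon>. feas \<eta> T \<tau> p \<theta> \<omega> \<epsilon> \<and>
           (\<forall>\<eta>' T' \<tau>' p' \<theta>' \<omega>' \<epsilon>'. feas \<eta>' T' \<tau>' p' \<theta>' \<omega>' \<epsilon>' \<longrightarrow> \<eta>' \<le> \<eta>))"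


section \<open>The alternating algorithm\<close>

(* Th l and tauh l are the half-step values T^{l+0.5} and tau^{l+0.5}.  The stopping rule is not
   part of a run; termination is the statement that it is met eventually. *)
definition ao_run :: "uav_sys \<Rightarrow> (nat \<Rightarrow> path) \<Rightarrow> (nat \<Rightarrow> seg_var) \<Rightarrow> (nat \<Rightarrow> node_var) \<Rightarrow>
    (nat \<Rightarrow> node_var) \<Rightarrow> (nat \<Rightarrow> seg_var) \<Rightarrow> (nat \<Rightarrow> node_var) \<Rightarrow> bool" where
  "ao_run S u T \<tau> p Th \<tau>h \<longleftrightarrow>
     P_feasible_point S (u 0) (T 0) (\<tau> 0) (p 0) \<and>
     (\<forall>l. A_solution S (u l) (T l) (\<tau> l) (p l) (u (Suc l)) (Th l) (\<tau>h l) \<and>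
          B_solution S (u (Suc l)) (Th l) (\<tau>h l) (p l) (T (Suc l)) (\<tau> (Suc l)) (p (Suc l)))"

(* In ereal: 0 / 0 = 0, and an increase from 0 to a positive value is infinite. *)
definition frac_increase :: "real \<Rightarrow> real \<Rightarrow> ereal" where
  "frac_increase a b = ereal (b - a) / ereal a"

end

theory Submission
  imports Defs
begin

text \<open>
  A (P)-feasible point, completed by the auxiliary variables that satisfy their constraints with
  equality, is feasible for the subproblem approximated at it, because a Taylor bound is tight at
  its local point; so the optimal value of the subproblem is at least the current objective.
  Conversely the Taylor bounds are global lower bounds of convex functions, so every point feasible
  for a subproblem is (P)-feasible and its true objective is at least its surrogate objective.
  The energy budget of the UAV bounds all durations, hence the throughput.
\<close>

section \<open>Quotients in \<open>ereal\<close> and first-order Taylor lower bounds\<close>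

text \<open>For \<open>b = 0\<close> the quotient is 0 or \<infinity> according to whether
  \<open>a = 0\<close>, which the product form captures together with \<open>0 \<le> c\<close>; for
  \<open>b > 0\<close> the sign of \<open>c\<close> follows from \<open>0 \<le> a\<close>. Every
  constraint with a possibly vanishing denominator is cleared this way.\<close>

lemma ereal_divide_le_iff:
  fixes a b c :: real
  assumes "0 \<le> a" "0 \<le> b"
  shows "ereal a / ereal b \<le> ereal c \<longleftrightarrow> a \<le> b * c \<and> 0 \<le> c"
proof (cases "b = 0")
  case True
  then show ?thesis
    using assms by (cases "a = 0") (auto simp: divide_ereal_def zero_ereal_def[symmetric])
next
  case False
  then have b: "0 < b" using assms by simp
  then have "0 \<le> c" if "a \<le> b * c"
    using that assms by (metis mult_less_cancel_left_pos mult_zero_right not_le order_trans)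
  then show ?thesis
    using b by (auto simp: pos_divide_le_eq mult.commute)
qed

lemma ereal_divide_leD:
  "0 \<le> a \<Longrightarrow> 0 \<le> b \<Longrightarrow> ereal a / ereal b \<le> ereal c \<Longrightarrow> a \<le> b * c"
  by (simp only: ereal_divide_le_iff)

lemma square_ge_tangent: "(c::real)\<^sup>2 + 2 * c * (x - c) \<le> x\<^sup>2"
  using zero_le_power2[of "x - c"] by (simp add: power2_eq_square algebra_simps)

text \<open>The two sides differ by the squared norm of \<open>x - c\<close>. It is applied to the
  segment vectors in the \<omega>-constraint of (A).\<close>

lemma norm_square_ge_tangent:
  fixes c x :: "'a::real_inner"
  shows "- (norm c)\<^sup>2 + 2 * (c \<bullet> x) \<le> (norm x)\<^sup>2"
  using zero_le_power2[of "norm (x - c)"]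
  unfolding power2_norm_eq_inner by (simp add: inner_diff_left inner_diff_right inner_commute)

text \<open>The map from \<open>z\<close> to \<open>log 2 (1 + g / z)\<close> is convex for
  \<open>z > 0\<close>, and the left side is its tangent at \<open>D\<close>. The bound
  \<open>ln q \<le> q - 1\<close> replaces a computation of derivatives.\<close>

lemma log_one_plus_inverse_ge_tangent:
  fixes g D z :: real
  assumes "0 \<le> g" "0 < D" "0 < z"
  shows "log 2 (1 + g / D) - log 2 (exp 1) * g / (D * (D + g)) * (z - D) \<le> log 2 (1 + g / z)"
proof -
  have pos: "0 < 1 + g / D" "0 < 1 + g / z" "0 < D + g" "0 < z + g"
    using assms by (auto intro: add_pos_nonneg)
  define q where "q = (1 + g / D) / (1 + g / z)"
  have "0 < q" using pos by (simp add: q_def)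
  have "ln (1 + g / D) - ln (1 + g / z) = ln q"
    using pos by (simp add: q_def ln_div)
  also have "\<dots> \<le> q - 1"
    using \<open>0 < q\<close> by (rule ln_le_minus_one)
  also have "\<dots> = g * (z - D) / (D * (z + g))"
  proof -
    have "D * g + D * z \<noteq> 0"
      using assms pos by (simp flip: distrib_left add: add.commute)
    then show ?thesis
      using assms pos unfolding q_def by (simp add: field_simps)
  qed
  \<comment> \<open>Replacing \<open>z + g\<close> by \<open>D + g\<close> is an upper estimate for
    either sign of \<open>z - D\<close>, since the difference is a nonnegative multiple of its
    square.\<close>
  also have "\<dots> \<le> g * (z - D) / (D * (D + g))"
  proof -
    have "g * (z - D) / (D * (D + g)) - g * (z - D) / (D * (z + g))
        = g * (z - D)\<^sup>2 / (D * (D + g) * (z + g))"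
      using assms pos by (simp add: divide_simps power2_eq_square) (simp add: algebra_simps)
    also have "\<dots> \<ge> 0"
      using assms pos by simp
    finally show ?thesis by simp
  qed
  finally have "ln (1 + g / D) - g * (z - D) / (D * (D + g)) \<le> ln (1 + g / z)" by simp
  then have "(ln (1 + g / D) - g * (z - D) / (D * (D + g))) / ln 2 \<le> ln (1 + g / z) / ln 2"
    by (simp add: divide_right_mono)
  then show ?thesis
    by (simp add: log_def diff_divide_distrib mult.commute)
qed

section \<open>Bounds on rates and durations, and the optimal \<omega>\<close>

context
  fixes S :: uav_sys
  assumes valid: "valid_sys S"
begin

lemma sq_dist_pos: "0 < sq_dist S u k n"
  using valid by (auto simp: sq_dist_def valid_sys_def intro: add_nonneg_pos)

lemma rate_nonneg: "0 \<le> p k n \<Longrightarrow> 0 \<le> rate S u p k n"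
  using valid sq_dist_pos[of u k n] unfolding rate_def
  by (subst zero_le_log_cancel_iff) (auto simp: valid_sys_def intro!: add_pos_nonneg)

text \<open>The rate is convex in the squared distance with slope \<open>- phi\<close> at the local
  point; the height cancels in the difference of two values of \<open>sq_dist\<close>.\<close>

lemma rate_ge_tangent:
  assumes "0 \<le> p k n"
  shows "log 2 (1 + gamma0 S * p k n / sq_dist S uc k n)
      - phi S uc p k n * ((norm (u n - node_pos S k))\<^sup>2 - (norm (uc n - node_pos S k))\<^sup>2)
    \<le> rate S u p k n"
  using log_one_plus_inverse_ge_tangent[of "gamma0 S * p k n" "sq_dist S uc k n" "sq_dist S u k n"]
    assms valid sq_dist_pos[of u k n] sq_dist_pos[of uc k n]
  by (simp add: rate_def phi_def valid_sys_def sq_dist_def mult.assoc)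

text \<open>The best case is full power with the UAV directly above the node.\<close>

lemma rate_le:
  assumes "0 \<le> p k n" "p k n \<le> p_max S"
  shows "rate S u p k n \<le> log 2 (1 + gamma0 S * p_max S / (height S)\<^sup>2)"
proof -
  have pos: "0 < gamma0 S" "0 < height S"
    using valid by (auto simp: valid_sys_def)
  have "gamma0 S * p k n / sq_dist S u k n \<le> gamma0 S * p_max S / (height S)\<^sup>2"
    using assms pos by (intro frac_le) (auto simp: sq_dist_def)
  moreover have "0 \<le> gamma0 S * p k n / sq_dist S u k n"
    using assms pos sq_dist_pos[of u k n] by simp
  ultimately show ?thesis
    unfolding rate_def by (subst log_le_cancel_iff) auto
qed

lemma T_nonneg:
  assumes "con_iv S T \<tau>" "con_v S \<tau>" "n \<in> {1..segs S}"
  shows "0 \<le> T n"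
proof -
  have "0 \<le> (\<Sum>k=1..nodes S. \<tau> k n)"
    using assms by (intro sum_nonneg) (auto simp: con_v_def)
  also have "\<dots> \<le> T n"
    using assms unfolding con_iv_def by blast
  finally show ?thesis .
qed

text \<open>With \<open>a\<close> half the squared ratio of \<open>seg_length u n\<close> to
  \<open>v_ind S\<close>, the square of \<open>omega_of\<close> is the nonnegative root
  \<open>r - a\<close> of \<open>x * (x + 2 * a) = (T n)^4\<close>: the \<omega>-constraint of (P)
  holds with equality.\<close>

lemma omega_of_nonneg: "0 \<le> omega_of S u T n"
  and omega_of_eq:
    "(T n)^4 = (omega_of S u T n)\<^sup>2 * ((omega_of S u T n)\<^sup>2 + (seg_length u n)\<^sup>2 / (v_ind S)\<^sup>2)"
proof -
  define a where "a = (seg_length u n)\<^sup>2 / (2 * (v_ind S)\<^sup>2)"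
  have a: "0 \<le> a" "(seg_length u n)^4 / (4 * (v_ind S)^4) = a\<^sup>2"
    "(seg_length u n)\<^sup>2 / (v_ind S)\<^sup>2 = 2 * a"
    by (simp_all add: a_def power_divide power_mult_distrib flip: power_mult)
  define r where "r = sqrt ((T n)^4 + a\<^sup>2)"
  have r2: "r\<^sup>2 = (T n)^4 + a\<^sup>2"
    by (simp add: r_def)
  have "a \<le> r"
    unfolding r_def by (rule real_le_rsqrt) simp
  have w: "omega_of S u T n = sqrt (r - a)"
    unfolding omega_of_def a(2) r_def a_def ..
  show "0 \<le> omega_of S u T n"
    using \<open>a \<le> r\<close> by (simp add: w)
  show "(T n)^4 = (omega_of S u T n)\<^sup>2 * ((omega_of S u T n)\<^sup>2 + (seg_length u n)\<^sup>2 / (v_ind S)\<^sup>2)"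
    using \<open>a \<le> r\<close> r2 unfolding w a(3) by (simp add: algebra_simps power2_eq_square)
qed

text \<open>The right side of the constraint increases strictly with \<omega> \<ge> 0, so the value
  giving equality is the least admissible one.\<close>

lemma omega_of_le:
  assumes "0 \<le> \<omega>" "(T n)^4 \<le> \<omega>\<^sup>2 * (\<omega>\<^sup>2 + (seg_length u n)\<^sup>2 / (v_ind S)\<^sup>2)"
  shows "omega_of S u T n \<le> \<omega>"
proof (rule ccontr)
  assume "\<not> omega_of S u T n \<le> \<omega>"
  then have "\<omega>\<^sup>2 < (omega_of S u T n)\<^sup>2"
    using assms by (intro power_strict_mono) auto
  then have "\<omega>\<^sup>2 * (\<omega>\<^sup>2 + (seg_length u n)\<^sup>2 / (v_ind S)\<^sup>2)
      < (omega_of S u T n)\<^sup>2 * ((omega_of S u T n)\<^sup>2 + (seg_length u n)\<^sup>2 / (v_ind S)\<^sup>2)"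
    by (intro mult_strict_mono) (auto intro: add_pos_nonneg order_le_less_trans[OF zero_le_power2])
  then show False
    using assms omega_of_eq[of T n u] by simp
qed

lemma con_E_mono:
  assumes "con_E S u T \<omega>" "\<And>n. n \<in> {1..segs S} \<Longrightarrow> \<omega>' n \<le> \<omega> n"
  shows "con_E S u T \<omega>'"
proof -
  have "P_ind S * (\<Sum>n=1..segs S. \<omega>' n) \<le> P_ind S * (\<Sum>n=1..segs S. \<omega> n)"
    using valid assms(2) by (intro mult_left_mono sum_mono) (auto simp: valid_sys_def)
  then show ?thesis
    using assms(1) unfolding con_E_def
    by (elim order_trans[rotated]) (intro add_mono order_refl, simp)
qed

text \<open>All terms of the energy sum are nonnegative, so the blade power spent during segment
  \<open>n\<close> alone stays within \<open>E_uav S\<close>.\<close>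

lemma T_le:
  assumes E: "con_E S u T \<omega>" and \<omega>: "omega_nonneg S \<omega>"
    and T: "\<And>n. n \<in> {1..segs S} \<Longrightarrow> 0 \<le> T n" and n: "n \<in> {1..segs S}"
  shows "T n \<le> E_uav S / P_blade S"
proof -
  have pos: "0 < P_blade S" "0 < P_ind S" "0 < d_drag S" "0 < rho_air S" "0 < s_rotor S" "0 < A_rotor S"
    using valid by (auto simp: valid_sys_def)
  let ?a = "\<lambda>n. ereal (3 * (seg_length u n)\<^sup>2) / ereal ((U_tip S)\<^sup>2 * T n)"
  let ?b = "\<lambda>n. ereal ((seg_length u n)^3) / ereal ((T n)\<^sup>2)"
  have s: "0 \<le> seg_length u m" for m
    by (simp add: seg_length_def)
  have quot: "0 \<le> ereal x / ereal y" if "0 \<le> x" "0 \<le> y" for x y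
    using that by (cases "y = 0") (auto simp: divide_ereal_def zero_ereal_def[symmetric])
  have a: "0 \<le> ?a m" if "m \<in> {1..segs S}" for m
    using T[OF that] by (intro quot) auto
  have b: "0 \<le> (\<Sum>m=1..segs S. ?b m)"
    using s by (intro sum_nonneg quot) auto
  have "ereal (T n) \<le> ereal (T n) + ?a n"
    using add_left_mono[OF a[OF n], of "ereal (T n)"] by simp
  also have "\<dots> \<le> (\<Sum>m=1..segs S. ereal (T m) + ?a m)"
    using a T n sum_mono2[of "{1..segs S}" "{n}" "\<lambda>m. ereal (T m) + ?a m"]
    by (auto simp del: One_nat_def)
  finally have "ereal (P_blade S) * ereal (T n)
      \<le> ereal (P_blade S) * (\<Sum>m=1..segs S. ereal (T m) + ?a m)"
    using pos by (intro ereal_mult_left_mono) auto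
  also have "\<dots> \<le> \<dots> + (ereal (P_ind S * (\<Sum>n=1..segs S. \<omega> n))
      + ereal (1/2 * d_drag S * rho_air S * s_rotor S * A_rotor S) * (\<Sum>m=1..segs S. ?b m))"
  proof -
    have "0 \<le> ereal (P_ind S * (\<Sum>n=1..segs S. \<omega> n))"
      using pos \<omega> by (auto simp: omega_nonneg_def intro!: mult_nonneg_nonneg sum_nonneg)
    moreover have "0 \<le> ereal (1/2 * d_drag S * rho_air S * s_rotor S * A_rotor S) * (\<Sum>m=1..segs S. ?b m)"
      using pos b by (intro ereal_0_le_mult) auto
    ultimately show ?thesis
      by (intro add_increasing2 add_nonneg_nonneg order_refl)
  qed
  also have "\<dots> \<le> ereal (E_uav S)"
    using E unfolding con_E_def by (simp add: add.assoc)
  finally show ?thesis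
    using pos by (simp add: field_simps)
qed

section \<open>The objective and the feasible points of (P)\<close>

lemma max_min_obj_le:
  assumes "k \<in> {1..nodes S}"
  shows "max_min_obj S u T \<tau> p \<le> throughput S u \<tau> p k"
  unfolding max_min_obj_def using assms by (intro Min_le) auto

lemma max_min_obj_geI:
  assumes "\<And>k. k \<in> {1..nodes S} \<Longrightarrow> \<eta> \<le> throughput S u \<tau> p k"
  shows "\<eta> \<le> max_min_obj S u T \<tau> p"
  unfolding max_min_obj_def using assms valid by (intro Min.boundedI) (auto simp: valid_sys_def)

text \<open>Clearing the denominator bounds each squared \<theta> by the data sent in that segment,
  also when no time is allotted.\<close>

lemma P_feasible_le_max_min_obj:
  assumes "P_feasible S \<eta> u T \<tau> p \<theta> \<omega>"
  shows "\<eta> \<le> max_min_obj S u T \<tau> p"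
proof (rule max_min_obj_geI)
  fix k assume k: "k \<in> {1..nodes S}"
  have "\<eta> \<le> (\<Sum>n=1..segs S. (\<theta> k n)\<^sup>2)"
    using assms k by (auto simp: P_feasible_def)
  also have "\<dots> \<le> throughput S u \<tau> p k"
    unfolding throughput_def
  proof (rule sum_mono)
    fix n assume "n \<in> {1..segs S}"
    then have "0 \<le> \<tau> k n" "ereal ((\<theta> k n)\<^sup>2) / ereal (\<tau> k n) \<le> ereal (rate S u p k n)"
      using assms k unfolding P_feasible_def con_v_def by blast+
    then show "(\<theta> k n)\<^sup>2 \<le> \<tau> k n * rate S u p k n"
      by (intro ereal_divide_leD) auto
  qed
  finally show "\<eta> \<le> throughput S u \<tau> p k" .
qed

text \<open>The witness \<omega> of feasibility can only be larger than \<open>omega_of\<close>, and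
  a smaller \<omega> costs less energy.\<close>

lemma P_feasible_point_con_E_omega_of:
  assumes "P_feasible_point S u T \<tau> p"
  shows "con_E S u T (omega_of S u T)"
proof -
  obtain \<eta> \<theta> \<omega> where f: "P_feasible S \<eta> u T \<tau> p \<theta> \<omega>"
    using assms by (auto simp: P_feasible_point_def)
  show ?thesis
  proof (rule con_E_mono)
    show "con_E S u T \<omega>" using f by (simp add: P_feasible_def)
    fix n assume n: "n \<in> {1..segs S}"
    have "0 \<le> \<omega> n" "ereal ((T n)^4) / ereal ((\<omega> n)\<^sup>2)
        \<le> ereal ((\<omega> n)\<^sup>2 + (seg_length u n)\<^sup>2 / (v_ind S)\<^sup>2)"
      using f n unfolding P_feasible_def omega_nonneg_def seg_length_def by blast+
    then show "omega_of S u T n \<le> \<omega> n"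
      by (intro omega_of_le ereal_divide_leD) auto
  qed
qed

lemma P_feasible_pointD:
  assumes "P_feasible_point S u T \<tau> p"
  shows "con_i S u" "con_ii S u T" "con_iii S \<tau> p" "con_iv S T \<tau>" "con_v S \<tau>" "con_vi S p"
  using assms by (auto simp: P_feasible_point_def P_feasible_def)

lemma theta_of_square:
  assumes "con_v S \<tau>" "con_vi S p" "k \<in> {1..nodes S}" "n \<in> {1..segs S}"
  shows "(theta_of S u \<tau> p k n)\<^sup>2 = \<tau> k n * rate S u p k n"
  using assms rate_nonneg[of p k n u] by (simp add: theta_of_def con_v_def con_vi_def)

lemma sum_theta_of_square:
  assumes "con_v S \<tau>" "con_vi S p" "k \<in> {1..nodes S}"
  shows "(\<Sum>n=1..segs S. (theta_of S u \<tau> p k n)\<^sup>2) = throughput S u \<tau> p k"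
  unfolding throughput_def using assms by (intro sum.cong) (auto simp: theta_of_square)

lemma max_min_obj_nonneg:
  assumes "con_v S \<tau>" "con_vi S p"
  shows "0 \<le> max_min_obj S u T \<tau> p"
  using assms rate_nonneg
  by (intro max_min_obj_geI) (auto simp: throughput_def con_v_def con_vi_def intro!: sum_nonneg)

lemma omega_of_quotient_le:
  "ereal ((T n)^4) / ereal ((omega_of S u T n)\<^sup>2)
    \<le> ereal ((omega_of S u T n)\<^sup>2 + (seg_length u n)\<^sup>2 / (v_ind S)\<^sup>2)"
  using omega_of_eq[of T n u] by (subst ereal_divide_le_iff) auto

section \<open>Subproblem (A)\<close>

lemma A_feasible_local_point:
  assumes f: "P_feasible_point S u T \<tau> p"
  shows "A_feasible S p u (theta_of S u \<tau> p) (omega_of S u T) (max_min_obj S u T \<tau> p)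
    u T \<tau> (theta_of S u \<tau> p) (omega_of S u T)"
proof -
  note c = P_feasible_pointD[OF f]
  have "max_min_obj S u T \<tau> p \<le> (\<Sum>n=1..segs S. (theta_of S u \<tau> p k n)\<^sup>2)"
    if "k \<in> {1..nodes S}" for k
    using that c by (simp add: sum_theta_of_square max_min_obj_le del: One_nat_def)
  moreover have "ereal ((theta_of S u \<tau> p k n)\<^sup>2) / ereal (\<tau> k n)
      \<le> ereal (log 2 (1 + gamma0 S * p k n / sq_dist S u k n) - phi S u p k n *
          ((norm (u n - node_pos S k))\<^sup>2 - (norm (u n - node_pos S k))\<^sup>2))"
    if "k \<in> {1..nodes S}" "n \<in> {1..segs S}" for k n
    using that c rate_nonneg[of p k n u]
    by (subst ereal_divide_le_iff) (auto simp: theta_of_square con_v_def con_vi_def rate_def)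
  moreover have "ereal ((T n)^4) / ereal ((omega_of S u T n)\<^sup>2)
      \<le> ereal ((omega_of S u T n)\<^sup>2 + 2 * omega_of S u T n * (omega_of S u T n - omega_of S u T n)
          - (norm (u (n + 1) - u n))\<^sup>2 / (v_ind S)\<^sup>2
          + 2 / (v_ind S)\<^sup>2 * ((u (n + 1) - u n) \<bullet> (u (n + 1) - u n)))" for n
  proof -
    \<comment> \<open>At the local point the inner product is the squared segment length, so twice
      it minus once it leaves exactly the term of (P).\<close>
    have "(omega_of S u T n)\<^sup>2 + 2 * omega_of S u T n * (omega_of S u T n - omega_of S u T n)
          - (norm (u (n + 1) - u n))\<^sup>2 / (v_ind S)\<^sup>2
          + 2 / (v_ind S)\<^sup>2 * ((u (n + 1) - u n) \<bullet> (u (n + 1) - u n))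
        = (omega_of S u T n)\<^sup>2 + (seg_length u n)\<^sup>2 / (v_ind S)\<^sup>2"
      by (simp add: seg_length_def dot_square_norm)
    then show ?thesis
      using omega_of_quotient_le by (simp only:)
  qed
  moreover have "omega_nonneg S (omega_of S u T)"
    by (simp add: omega_nonneg_def omega_of_nonneg)
  ultimately show ?thesis
    using c P_feasible_point_con_E_omega_of[OF f]
    unfolding A_feasible_def by (intro conjI ballI) (assumption | simp)+
qed

text \<open>Each Taylor bound lies below the function it replaces, whatever the local point.
  Constraint (vi) is assumed because (A) fixes the powers and does not list it.\<close>

lemma A_feasible_imp_P_feasible:
  assumes f: "A_feasible S p uc thc omc \<eta> u T \<tau> \<theta> \<omega>" and vi: "con_vi S p"
  shows "P_feasible S \<eta> u T \<tau> p \<theta> \<omega>"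
proof -
  have "\<eta> \<le> (\<Sum>n=1..segs S. (\<theta> k n)\<^sup>2)" if "k \<in> {1..nodes S}" for k
  proof -
    have "\<eta> \<le> (\<Sum>n=1..segs S. (thc k n)\<^sup>2 + 2 * thc k n * (\<theta> k n - thc k n))"
      using f that by (auto simp: A_feasible_def)
    also have "\<dots> \<le> (\<Sum>n=1..segs S. (\<theta> k n)\<^sup>2)"
      by (intro sum_mono square_ge_tangent)
    finally show ?thesis .
  qed
  moreover have "ereal ((\<theta> k n)\<^sup>2) / ereal (\<tau> k n) \<le> ereal (rate S u p k n)"
    if kn: "k \<in> {1..nodes S}" "n \<in> {1..segs S}" for k n
  proof -
    have "ereal ((\<theta> k n)\<^sup>2) / ereal (\<tau> k n)
        \<le> ereal (log 2 (1 + gamma0 S * p k n / sq_dist S uc k n) - phi S uc p k n *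
            ((norm (u n - node_pos S k))\<^sup>2 - (norm (uc n - node_pos S k))\<^sup>2))"
      using f kn unfolding A_feasible_def by blast
    also have "\<dots> \<le> ereal (rate S u p k n)"
      using vi kn by (simp add: con_vi_def rate_ge_tangent)
    finally show ?thesis .
  qed
  moreover have "ereal ((T n)^4) / ereal ((\<omega> n)\<^sup>2)
        \<le> ereal ((\<omega> n)\<^sup>2 + (norm (u (n + 1) - u n))\<^sup>2 / (v_ind S)\<^sup>2)"
    if n: "n \<in> {1..segs S}" for n
  proof -
    let ?x = "u (n + 1) - u n" and ?c = "uc (n + 1) - uc n"
    have "ereal ((T n)^4) / ereal ((\<omega> n)\<^sup>2)
        \<le> ereal ((omc n)\<^sup>2 + 2 * omc n * (\<omega> n - omc n)
          - (norm ?c)\<^sup>2 / (v_ind S)\<^sup>2 + 2 / (v_ind S)\<^sup>2 * (?c \<bullet> ?x))"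
      using f n unfolding A_feasible_def by blast
    also have "\<dots> \<le> ereal ((\<omega> n)\<^sup>2 + (norm ?x)\<^sup>2 / (v_ind S)\<^sup>2)"
      using square_ge_tangent[of "omc n" "\<omega> n"]
        divide_right_mono[OF norm_square_ge_tangent[of ?c ?x], of "(v_ind S)\<^sup>2"]
      by (simp add: add_divide_distrib diff_divide_distrib)
    finally show ?thesis .
  qed
  ultimately show ?thesis
    using f vi by (simp add: P_feasible_def A_feasible_def)
qed

text \<open>The optimal surrogate value lies between the two objectives. Feasibility is proved
  alongside so that the next subproblem can be treated in the same way.\<close>

lemma A_solution_improves:
  assumes f: "P_feasible_point S uc Tc \<tau>c p" and sol: "A_solution S uc Tc \<tau>c p u T \<tau>"
  shows "P_feasible_point S u T \<tau> p"
    and "max_min_obj S uc Tc \<tau>c p \<le> max_min_obj S u T \<tau> p"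
proof -
  obtain \<eta> \<theta> \<omega> where
    g: "A_feasible S p uc (theta_of S uc \<tau>c p) (omega_of S uc Tc) \<eta> u T \<tau> \<theta> \<omega>"
    and le: "max_min_obj S uc Tc \<tau>c p \<le> \<eta>"
    using sol A_feasible_local_point[OF f] unfolding A_solution_def Let_def by blast
  have P: "P_feasible S \<eta> u T \<tau> p \<theta> \<omega>"
    using A_feasible_imp_P_feasible[OF g] P_feasible_pointD[OF f] by simp
  then show "P_feasible_point S u T \<tau> p"
    by (auto simp: P_feasible_point_def)
  show "max_min_obj S uc Tc \<tau>c p \<le> max_min_obj S u T \<tau> p"
    using le P_feasible_le_max_min_obj[OF P] by simp
qed

section \<open>Subproblem (B)\<close>

text \<open>
  At a vanishing local time the affine bound of (B) forces zero power, so the local point itself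
  need not be feasible. Switching off the power where no time is allotted repairs this without
  changing the throughput.
\<close>

lemma B_feasible_local_point:
  assumes f: "P_feasible_point S u T \<tau> p"
  defines "q \<equiv> (\<lambda>k n. if \<tau> k n = 0 then 0 else p k n)"
  shows "B_feasible S u \<tau> (theta_of S u \<tau> p) (omega_of S u T) (epsilon_of \<tau> p)
    (max_min_obj S u T \<tau> p) T \<tau> q (theta_of S u \<tau> p) (omega_of S u T) (epsilon_of \<tau> p)"
proof -
  note c = P_feasible_pointD[OF f]
  have \<epsilon>: "(epsilon_of \<tau> p k n)\<^sup>2 = \<tau> k n * p k n"
    if "k \<in> {1..nodes S}" "n \<in> {1..segs S}" for k n
    using that c by (simp add: epsilon_of_def con_v_def con_vi_def)
  have "con_vi S q"
    using c valid by (auto simp: con_vi_def q_def valid_sys_def)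
  moreover have "max_min_obj S u T \<tau> p \<le> (\<Sum>n=1..segs S. (theta_of S u \<tau> p k n)\<^sup>2)"
    if "k \<in> {1..nodes S}" for k
    using that c by (simp add: sum_theta_of_square max_min_obj_le del: One_nat_def)
  moreover have "ereal ((theta_of S u \<tau> p k n)\<^sup>2) / ereal (\<tau> k n) \<le> ereal (rate S u q k n)"
    if "k \<in> {1..nodes S}" "n \<in> {1..segs S}" for k n
  proof -
    have "0 \<le> q k n" "0 \<le> \<tau> k n"
      using that \<open>con_vi S q\<close> c by (auto simp: con_vi_def con_v_def)
    \<comment> \<open>\<open>q\<close> and \<open>p\<close> differ only where the factor \<tau>
      vanishes.\<close>
    moreover have "(theta_of S u \<tau> p k n)\<^sup>2 = \<tau> k n * rate S u q k n"
      using that c by (subst theta_of_square) (auto simp: q_def rate_def)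
    ultimately show ?thesis
      using rate_nonneg[of q k n u] by (subst ereal_divide_le_iff) simp_all
  qed
  moreover have "(\<Sum>n=1..segs S. (epsilon_of \<tau> p k n)\<^sup>2) \<le> E_node S k"
    if "k \<in> {1..nodes S}" for k
    using that c by (simp add: \<epsilon> con_iii_def)
  \<comment> \<open>This is what remains of the affine bound at its local point: the power itself,
    or 0 through real division by zero.\<close>
  moreover have "q k n \<le> (epsilon_of \<tau> p k n)\<^sup>2 / \<tau> k n"
    if "k \<in> {1..nodes S}" "n \<in> {1..segs S}" for k n
    using that by (simp add: \<epsilon> q_def)
  ultimately show ?thesis
    using c P_feasible_point_con_E_omega_of[OF f] omega_of_nonneg omega_of_quotient_le[of T _ u]
    by (simp add: B_feasible_def omega_nonneg_def)
qed

text \<open>(B) controls the node energy only through \<epsilon>. The affine bound on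
  \<open>p\<close> minorizes the quotient of \<epsilon> squared by \<tau>, so multiplying by \<tau>
  recovers (iii) segment by segment.\<close>

lemma B_feasible_imp_P_feasible:
  assumes f: "B_feasible S u \<tau>c thc omc epc \<eta> T \<tau> p \<theta> \<omega> \<epsilon>"
    and i: "con_i S u" and ii: "con_ii S u T"
  shows "P_feasible S \<eta> u T \<tau> p \<theta> \<omega>"
proof -
  have "\<eta> \<le> (\<Sum>n=1..segs S. (\<theta> k n)\<^sup>2)" if "k \<in> {1..nodes S}" for k
  proof -
    have "\<eta> \<le> (\<Sum>n=1..segs S. (thc k n)\<^sup>2 + 2 * thc k n * (\<theta> k n - thc k n))"
      using f that by (auto simp: B_feasible_def)
    also have "\<dots> \<le> (\<Sum>n=1..segs S. (\<theta> k n)\<^sup>2)"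
      by (intro sum_mono square_ge_tangent)
    finally show ?thesis .
  qed
  moreover have "con_iii S \<tau> p"
    unfolding con_iii_def
  proof
    fix k assume k: "k \<in> {1..nodes S}"
    have "(\<Sum>n=1..segs S. \<tau> k n * p k n) \<le> (\<Sum>n=1..segs S. (\<epsilon> k n)\<^sup>2)"
    proof (rule sum_mono)
      fix n assume n: "n \<in> {1..segs S}"
      \<comment> \<open>With the slope \<open>a\<close> the affine bound reads \<open>2 a \<epsilon> - a\<^sup>2 \<tau>\<close>, also for vanishing local time,
        where \<open>a = 0\<close>.\<close>
      define a where "a = epc k n / \<tau>c k n"
      have "p k n \<le> (epc k n)\<^sup>2 / \<tau>c k n + 2 * epc k n / \<tau>c k n * (\<epsilon> k n - epc k n)
          - (epc k n)\<^sup>2 / (\<tau>c k n)\<^sup>2 * (\<tau> k n - \<tau>c k n)"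
        using f k n by (auto simp: B_feasible_def)
      also have "\<dots> = 2 * a * \<epsilon> k n - a\<^sup>2 * \<tau> k n"
        by (cases "\<tau>c k n = 0") (simp_all add: a_def field_simps power2_eq_square)
      finally have "\<tau> k n * p k n \<le> \<tau> k n * (2 * a * \<epsilon> k n - a\<^sup>2 * \<tau> k n)"
        using f k n by (intro mult_left_mono) (auto simp: B_feasible_def con_v_def)
      also have "\<dots> \<le> (\<epsilon> k n)\<^sup>2"
        using zero_le_power2[of "\<epsilon> k n - a * \<tau> k n"]
        by (simp add: power2_eq_square algebra_simps)
      finally show "\<tau> k n * p k n \<le> (\<epsilon> k n)\<^sup>2" .
    qed
    also have "\<dots> \<le> E_node S k"
      using f k by (auto simp: B_feasible_def)
    finally show "(\<Sum>n=1..segs S. \<tau> k n * p k n) \<le> E_node S k" .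
  qed
  moreover have "ereal ((T n)^4) / ereal ((\<omega> n)\<^sup>2)
        \<le> ereal ((\<omega> n)\<^sup>2 + (norm (u (n + 1) - u n))\<^sup>2 / (v_ind S)\<^sup>2)"
    if n: "n \<in> {1..segs S}" for n
  proof -
    have "ereal ((T n)^4) / ereal ((\<omega> n)\<^sup>2)
        \<le> ereal ((omc n)\<^sup>2 + 2 * omc n * (\<omega> n - omc n) + (seg_length u n)\<^sup>2 / (v_ind S)\<^sup>2)"
      using f n unfolding B_feasible_def by blast
    also have "\<dots> \<le> ereal ((\<omega> n)\<^sup>2 + (norm (u (n + 1) - u n))\<^sup>2 / (v_ind S)\<^sup>2)"
      using square_ge_tangent[of "omc n" "\<omega> n"] by (simp add: seg_length_def)
    finally show ?thesis .
  qed
  ultimately show ?thesis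
    using f i ii by (simp add: P_feasible_def B_feasible_def)
qed

lemma B_solution_improves:
  assumes f: "P_feasible_point S u Tc \<tau>c pc" and sol: "B_solution S u Tc \<tau>c pc T \<tau> p"
  shows "P_feasible_point S u T \<tau> p"
    and "max_min_obj S u Tc \<tau>c pc \<le> max_min_obj S u T \<tau> p"
proof -
  obtain \<eta> \<theta> \<omega> \<epsilon> where ii: "con_ii S u T" and
    g: "B_feasible S u \<tau>c (theta_of S u \<tau>c pc) (omega_of S u Tc) (epsilon_of \<tau>c pc) \<eta> T \<tau> p \<theta> \<omega> \<epsilon>"
    and le: "max_min_obj S u Tc \<tau>c pc \<le> \<eta>"
    \<comment> \<open>The competitor is the local point with idle powers switched off; its durations
      are unchanged and thus keep (ii).\<close>
    using sol B_feasible_local_point[OF f] P_feasible_pointD(2)[OF f]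
    unfolding B_solution_def Let_def by blast
  have P: "P_feasible S \<eta> u T \<tau> p \<theta> \<omega>"
    using B_feasible_imp_P_feasible[OF g _ ii] P_feasible_pointD[OF f] by simp
  then show "P_feasible_point S u T \<tau> p"
    by (auto simp: P_feasible_point_def)
  show "max_min_obj S u Tc \<tau>c pc \<le> max_min_obj S u T \<tau> p"
    using le P_feasible_le_max_min_obj[OF P] by simp
qed

section \<open>Boundedness and the stopping rule\<close>

text \<open>The minimum is at most the throughput of node 1, whose time in each segment is at most
  the duration and whose rate is at most the best-case rate.\<close>

lemma max_min_obj_upper_bound:
  assumes f: "P_feasible_point S u T \<tau> p"
  shows "max_min_obj S u T \<tau> p
    \<le> real (segs S) * (E_uav S / P_blade S * log 2 (1 + gamma0 S * p_max S / (height S)\<^sup>2))"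
proof -
  note c = P_feasible_pointD[OF f]
  have one: "1 \<in> {1..nodes S}"
    using valid by (simp add: valid_sys_def)
  have "\<tau> 1 n * rate S u p 1 n
      \<le> E_uav S / P_blade S * log 2 (1 + gamma0 S * p_max S / (height S)\<^sup>2)"
    if n: "n \<in> {1..segs S}" for n
  proof (rule mult_mono)
    have "\<tau> 1 n \<le> (\<Sum>k=1..nodes S. \<tau> k n)"
      using c one n by (intro member_le_sum) (auto simp: con_v_def)
    also have "\<dots> \<le> T n"
      using c n by (simp add: con_iv_def)
    also have "\<dots> \<le> E_uav S / P_blade S"
      using n c omega_of_nonneg
      by (intro T_le[OF P_feasible_point_con_E_omega_of[OF f]]) (auto simp: omega_nonneg_def T_nonneg)
    finally show "\<tau> 1 n \<le> E_uav S / P_blade S" .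
    show "0 \<le> E_uav S / P_blade S"
      using valid by (simp add: valid_sys_def)
  qed (use c one n in \<open>auto simp: con_vi_def rate_le rate_nonneg\<close>)
  then have "throughput S u \<tau> p 1
      \<le> (\<Sum>n=1..segs S. E_uav S / P_blade S * log 2 (1 + gamma0 S * p_max S / (height S)\<^sup>2))"
    unfolding throughput_def by (rule sum_mono)
  then show ?thesis
    using max_min_obj_le[OF one, of u T \<tau> p] by simp
qed

end

text \<open>Increments of a convergent sequence tend to 0, while a monotone sequence with one
  positive value \<open>a m\<close> stays at or above it. If all values vanish, the convention 0 / 0
  = 0 meets the threshold.\<close>

lemma frac_increase_eventually_small:
  fixes a :: "nat \<Rightarrow> real"
  assumes inc: "incseq a" and conv: "convergent a" and nonneg: "\<And>l. 0 \<le> a l" and "0 < \<xi>"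
  shows "\<exists>l. frac_increase (a l) (a (Suc l)) < ereal \<xi>"
proof (cases "\<forall>l. a l = 0")
  case True
  then show ?thesis
    using \<open>0 < \<xi>\<close> by (simp add: frac_increase_def divide_ereal_def flip: zero_ereal_def)
next
  case False
  then obtain m where m: "0 < a m"
    using nonneg by (metis less_eq_real_def)
  obtain L where L: "a \<longlonglongrightarrow> L"
    using conv by (auto simp: convergent_def)
  then have "(\<lambda>l. a (Suc l) - a l) \<longlonglongrightarrow> L - L"
    by (intro tendsto_diff LIMSEQ_Suc)
  \<comment> \<open>The fixed positive bound \<open>\<xi> * a m\<close> stands in for
    \<open>\<xi> * a l\<close>, which varies with \<open>l\<close>.\<close>
  then have "\<forall>\<^sub>F l in sequentially. a (Suc l) - a l < \<xi> * a m"
    using m \<open>0 < \<xi>\<close> by (intro order_tendstoD(2)) auto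
  then have "\<forall>\<^sub>F l in sequentially. m \<le> l \<and> a (Suc l) - a l < \<xi> * a m"
    using eventually_ge_at_top by (rule eventually_conj[rotated])
  then obtain l where l: "m \<le> l" "a (Suc l) - a l < \<xi> * a m"
    using eventually_happens'[OF sequentially_bot] by blast
  have "a m \<le> a l"
    using inc l(1) by (rule incseqD)
  then have "\<xi> * a m \<le> \<xi> * a l"
    using \<open>0 < \<xi>\<close> by simp
  then have "a (Suc l) - a l < \<xi> * a l"
    using l(2) by linarith
  then show ?thesis
    using m \<open>a m \<le> a l\<close> by (intro exI[of _ l]) (simp add: frac_increase_def pos_divide_less_eq)
qed

theorem mainTheorem1:
  fixes S :: uav_sys
    and u :: "nat \<Rightarrow> nat \<Rightarrow> real^2"
    and T Th :: "nat \<Rightarrow> nat \<Rightarrow> real"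
    and \<tau> p \<tau>h :: "nat \<Rightarrow> nat \<Rightarrow> nat \<Rightarrow> real"
  assumes "valid_sys S"
    and "ao_run S u T \<tau> p Th \<tau>h"
  shows "(\<forall>l. max_min_obj S (u l) (T l) (\<tau> l) (p l)
                \<le> max_min_obj S (u (Suc l)) (Th l) (\<tau>h l) (p l)
            \<and> max_min_obj S (u (Suc l)) (Th l) (\<tau>h l) (p l)
                \<le> max_min_obj S (u (Suc l)) (T (Suc l)) (\<tau> (Suc l)) (p (Suc l)))
    \<and> incseq (\<lambda>l. max_min_obj S (u l) (T l) (\<tau> l) (p l))
    \<and> bdd_above {max_min_obj S u' T' \<tau>' p' | u' T' \<tau>' p'. P_feasible_point S u' T' \<tau>' p'}
    \<and> convergent (\<lambda>l. max_min_obj S (u l) (T l) (\<tau> l) (p l))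
    \<and> (\<forall>\<xi>>0. \<exists>l. frac_increase (max_min_obj S (u l) (T l) (\<tau> l) (p l))
                    (max_min_obj S (u (Suc l)) (T (Suc l)) (\<tau> (Suc l)) (p (Suc l))) < ereal \<xi>)"
proof -
  let ?f = "\<lambda>l. max_min_obj S (u l) (T l) (\<tau> l) (p l)"
  let ?h = "\<lambda>l. max_min_obj S (u (Suc l)) (Th l) (\<tau>h l) (p l)"
  note A = A_solution_improves[OF assms(1)] and B = B_solution_improves[OF assms(1)]
  have init: "P_feasible_point S (u 0) (T 0) (\<tau> 0) (p 0)"
    and solA: "A_solution S (u l) (T l) (\<tau> l) (p l) (u (Suc l)) (Th l) (\<tau>h l)"
    and solB: "B_solution S (u (Suc l)) (Th l) (\<tau>h l) (p l) (T (Suc l)) (\<tau> (Suc l)) (p (Suc l))" for l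
    using assms(2) by (auto simp: ao_run_def)
  \<comment> \<open>Only the start is feasible by assumption; both half steps preserve feasibility,
    on which their improvement rests.\<close>
  have feas: "P_feasible_point S (u l) (T l) (\<tau> l) (p l)" for l
  proof (induction l)
    case (Suc l)
    show ?case by (rule B(1)[OF A(1)[OF Suc solA] solB])
  qed (rule init)
  have steps: "?f l \<le> ?h l \<and> ?h l \<le> ?f (Suc l)" for l
    using A(2)[OF feas solA] B(2)[OF A(1)[OF feas solA] solB] by blast
  then have inc: "incseq ?f"
    by (intro incseq_SucI) (meson order_trans)
  note bound = max_min_obj_upper_bound[OF assms(1)]
  have conv: "convergent ?f"
    by (rule incseq_convergent[OF inc, rule_format, OF bound[OF feas]]) (rule convergentI)
  have "0 \<le> ?f l" for l
    using P_feasible_pointD[OF assms(1) feas[of l]] by (intro max_min_obj_nonneg[OF assms(1)])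
  then have "\<exists>l. frac_increase (?f l) (?f (Suc l)) < ereal \<xi>" if "0 < \<xi>" for \<xi>
    using frac_increase_eventually_small[OF inc conv _ that] by blast
  moreover have "bdd_above {max_min_obj S u' T' \<tau>' p' | u' T' \<tau>' p'. P_feasible_point S u' T' \<tau>' p'}"
    by (rule bdd_aboveI) (auto simp only: mem_Collect_eq intro: bound)
  ultimately show ?thesis
    using steps inc conv by blast
qed

end
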